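(* Let $X \subseteq \mathbb{R}^n$ be open and let $\mathbf{f}: X \to \mathbb{R}^n$ be lexicographically smooth (L-smooth) at $\mathbf{x}_0 \in X$. Then $$\lim_{\mathbf{d} \to \mathbf{0}_n} \frac{1}{\|\mathbf{d}\|} \left\| \mathbf{f}(\mathbf{x}_0+\mathbf{d})-\mathbf{f}(\mathbf{x}_0)-\mathbf{f}'(\mathbf{x}_0;[\mathbf{d} \quad \mathbf{I}_n]) \begin{bmatrix} 0 \\ \mathbf{d} \end{bmatrix} \right\| = 0,$$ where $\mathbf{f}'(\mathbf{x}_0;[\mathbf{d} \quad \mathbf{I}_n]) \in \mathbb{R}^{n\times(1+n)}$ is the lexicographic directional derivative (LD-derivative) of $\mathbf{f}$ at $\mathbf{x}_0$ in the directions $[\mathbf{d} \quad \mathbf{I}_n]\in\mathbb{R}^{n\times(1+n)}$.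
   Context: $\mathbf{I}_n$ is the $n\times n$ identity matrix and $\mathbf{0}_n$ the zero vector in $\mathbb{R}^n$. Directional derivatives are one-sided: $\mathbf{f}'(\mathbf{x}_0;\mathbf{d})=\lim_{\alpha\to 0^+}\frac{\mathbf{f}(\mathbf{x}_0+\alpha\mathbf{d})-\mathbf{f}(\mathbf{x}_0)}{\alpha}$. L-smoothness: let $X\subseteq\mathbb{R}^n$ be open. A locally Lipschitz function $\mathbf{f}:X\to\mathbb{R}^m$ is lexicographically smooth (L-smooth) at $\mathbf{x}_0\in X$ if, for any $k\in\mathbb{N}$ and any directions matrix $\mathbf{M}=[\mathbf{m}_1 \; \mathbf{m}_2 \; \cdots \; \mathbf{m}_k]\in\mathbb{R}^{n\times k}$, the homogenization sequence $$\mathbf{f}^{(0)}=\mathbf{f}^{(0)}_{\mathbf{x}_0,\mathbf{M}}:\mathbb{R}^n\to\mathbb{R}^m:\mathbf{d}\mapsto \mathbf{f}'(\mathbf{x}_0;\mathbf{d}),\qquad \mathbf{f}^{(j)}=\mathbf{f}^{(j)}_{\mathbf{x}_0,\mathbf{M}}:\mathbb{R}^n\to\mathbb{R}^m:\mathbf{d}\mapsto [\mathbf{f}^{(j-1)}_{\mathbf{x}_0,\mathbf{M}}]'(\mathbf{m}_j;\mathbf{d}),\quad j=1,\dots,k,$$ exists. LD-derivative: the lexicographic directional derivative of an L-smooth $\mathbf{f}$ at $\mathbf{x}_0$ in the directions $\mathbf{M}\in\mathbb{R}^{n\times k}$ is the matrix $$\mathbf{f}'(\mathbf{x}_0;\mathbf{M}):=[\mathbf{f}^{(0)}_{\mathbf{x}_0,\mathbf{M}}(\mathbf{m}_1)\;\;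 \mathbf{f}^{(1)}_{\mathbf{x}_0,\mathbf{M}}(\mathbf{m}_2)\;\cdots\;\mathbf{f}^{(k-1)}_{\mathbf{x}_0,\mathbf{M}}(\mathbf{m}_k)]\in\mathbb{R}^{m\times k}.$$ *)

theory Defs
  imports "HOL-Analysis.Analysis" "HOL-Library.Option_ord"
begin

definition locally_lipschitz_on :: "'a::metric_space set \<Rightarrow> ('a \<Rightarrow> 'b::metric_space) \<Rightarrow> bool" where
  "locally_lipschitz_on X f \<longleftrightarrow> (\<forall>x\<in>X. \<exists>r>0. \<exists>L. L-lipschitz_on (cball x r \<inter> X) f)"

definition has_dir_deriv ::
    "('a::real_normed_vector \<Rightarrow> 'b::real_normed_vector) \<Rightarrow> 'b \<Rightarrow> 'a \<Rightarrow> 'a \<Rightarrow> bool" where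
  "has_dir_deriv f v x d \<longleftrightarrow> ((\<lambda>\<alpha>. (f (x + \<alpha> *\<^sub>R d) - f x) /\<^sub>R \<alpha>) \<longlongrightarrow> v) (at_right 0)"

text \<open>Only meaningful where the one-sided limit exists; unspecified elsewhere.\<close>

definition dir_deriv ::
    "('a::real_normed_vector \<Rightarrow> 'b::real_normed_vector) \<Rightarrow> 'a \<Rightarrow> 'a \<Rightarrow> 'b" where
  "dir_deriv f x d = (THE v. has_dir_deriv f v x d)"

text \<open>The directions are given as a sequence \<open>m\<close>, numbered from 1; the \<open>j\<close>-th function depends
  on \<open>m 1, \<dots>, m j\<close> only, so a matrix with \<open>k\<close> columns determines the functions numbered
  \<open>0, \<dots>, k\<close>.\<close>

primrec homogenization ::
    "('a::real_normed_vector \<Rightarrow> 'b::real_normed_vector) \<Rightarrow> 'a \<Rightarrow> (nat \<Rightarrow> 'a) \<Rightarrow> nat \<Rightarrow> 'a \<Rightarrow> 'b" where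
  "homogenization f x m 0 = dir_deriv f x"
| "homogenization f x m (Suc j) = dir_deriv (homogenization f x m j) (m (Suc j))"

definition homogenization_exists ::
    "('a::real_normed_vector \<Rightarrow> 'b::real_normed_vector) \<Rightarrow> 'a \<Rightarrow> nat \<Rightarrow> (nat \<Rightarrow> 'a) \<Rightarrow> bool" where
  "homogenization_exists f x k m \<longleftrightarrow>
     (\<forall>d. \<exists>v. has_dir_deriv f v x d) \<and>
     (\<forall>j<k. \<forall>d. \<exists>v. has_dir_deriv (homogenization f x m j) v (m (Suc j)) d)"

text \<open>\<open>f\<close> is total, but for open \<open>X\<close> and \<open>x \<in> X\<close> its values outside \<open>X\<close> are irrelevant.\<close>

definition L_smooth_at ::
    "(real ^ 'n) set \<Rightarrow> (real ^ 'n \<Rightarrow> real ^ 'm) \<Rightarrow> real ^ 'n \<Rightarrow> bool" where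
  "L_smooth_at X f x \<longleftrightarrow> locally_lipschitz_on X f \<and> (\<forall>k m. homogenization_exists f x k m)"

text \<open>The order of the columns of a matrix matters, so column index types are linearly ordered.
  The index \<open>j\<close> is the index number \<open>card {..<j} + 1\<close>, and \<open>nth_column M l\<close> is the column
  numbered \<open>l\<close>, for \<open>l = 1, \<dots>, CARD('k)\<close>.\<close>

definition nth_column :: "real ^ ('k::{finite,linorder}) ^ 'n \<Rightarrow> nat \<Rightarrow> real ^ 'n" where
  "nth_column M l = column (sorted_list_of_set UNIV ! (l - 1)) M"

definition LD_deriv ::
    "(real ^ 'n \<Rightarrow> real ^ 'm) \<Rightarrow> real ^ 'n \<Rightarrow> real ^ ('k::{finite,linorder}) ^ 'n \<Rightarrow> real ^ ('k::{finite,linorder}) ^ 'm" where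
  "LD_deriv f x M =
     (\<chi> i j. homogenization f x (nth_column M) (card {..<j}) (column j M) $ i)"

text \<open>Adjoining a first column to a matrix, or a first entry to a vector: the new first index is
  \<open>None\<close>, which is the least element in the order on \<open>option\<close>.\<close>

definition cons_column :: "real ^ 'n \<Rightarrow> real ^ 'k ^ 'n \<Rightarrow> real ^ 'k option ^ 'n" where
  "cons_column d A = (\<chi> i j. case j of None \<Rightarrow> d $ i | Some l \<Rightarrow> A $ i $ l)"

definition cons_entry :: "real \<Rightarrow> real ^ 'k \<Rightarrow> real ^ 'k option" where
  "cons_entry a v = (\<chi> j. case j of None \<Rightarrow> a | Some l \<Rightarrow> v $ l)"

end

theory Submission
  imports Defs
begin

text \<open>
  The proof has two halves. The first is algebraic: the correction term in the limit is nothing but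
  the directional derivative \<open>f'(x0; d)\<close>. Each homogenization is positively homogeneous, and
  differentiating a positively homogeneous function at \<open>m\<close> makes it affine in the direction \<open>m\<close>;
  once affine in a direction, a function remains so, with the same slope, under further
  differentiation. Hence the last homogenization \<open>f\<^sup>(\<^sup>k\<^sup>)\<close> for a directions matrix \<open>M\<close> is linear on
  the range of \<open>M\<close>, and it agrees there on the columns of \<open>M\<close> with the columns of the
  LD-derivative, so that \<open>f'(x0; M) w = f\<^sup>(\<^sup>k\<^sup>)(M w)\<close> (\<open>LD_deriv_mult_vec\<close>). For \<open>M = [d I]\<close> and
  \<open>w = [0; d]\<close> the argument \<open>M w\<close> is \<open>d\<close>, which is also the first column of \<open>M\<close>; and on that column
  the last homogenization still has the value of the first, \<open>f'(x0; d)\<close>.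

  The second half is the classical fact that a Lipschitz function on a finite-dimensional space
  that has all one-sided directional derivatives at a point is approximated by them to first
  order, uniformly in the direction (\<open>lipschitz_imp_B_differentiable\<close>): on a finite net of the
  unit sphere uniformity is automatic, and the Lipschitz bound controls the remaining directions.
\<close>

section \<open>One-sided directional derivatives\<close>

lemma has_dir_deriv_unique:
  assumes "has_dir_deriv f v x d" "has_dir_deriv f w x d"
  shows "v = w"
  using assms tendsto_unique[OF trivial_limit_at_right_real] unfolding has_dir_deriv_def by blast

lemma dir_deriv_eq:
  assumes "has_dir_deriv f v x d"
  shows "dir_deriv f x d = v"
  unfolding dir_deriv_def using assms has_dir_deriv_unique by blast

lemma has_dir_deriv_dir_deriv:
  assumes "\<exists>v. has_dir_deriv f v x d"
  shows "has_dir_deriv f (dir_deriv f x d) x d"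
  using assms dir_deriv_eq by metis

lemma has_dir_deriv_zero: "has_dir_deriv f 0 x 0"
  by (simp add: has_dir_deriv_def)

lemma filterlim_at_right_0_mult:
  fixes s :: "real \<Rightarrow> real"
  assumes "(s \<longlongrightarrow> a) (at_right 0)" "a > 0"
  shows "filterlim (\<lambda>\<alpha>. \<alpha> * s \<alpha>) (at_right 0) (at_right 0)"
proof -
  have "((\<lambda>\<alpha>. \<alpha> * s \<alpha>) \<longlongrightarrow> 0 * a) (at_right 0)"
    by (intro tendsto_intros assms)
  moreover have "eventually (\<lambda>\<alpha>. s \<alpha> > 0) (at_right 0)"
    using assms by (rule order_tendstoD)
  then have "eventually (\<lambda>\<alpha>. \<alpha> * s \<alpha> \<in> {0<..} \<and> \<alpha> * s \<alpha> \<noteq> 0) (at_right 0)"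
    using eventually_at_right_less by eventually_elim simp
  ultimately show ?thesis
    unfolding filterlim_at by simp
qed

lemma has_dir_deriv_scale:
  assumes "has_dir_deriv f v x d" "c \<ge> 0"
  shows "has_dir_deriv f (c *\<^sub>R v) x (c *\<^sub>R d)"
proof (cases "c = 0")
  case True
  then show ?thesis by (simp add: has_dir_deriv_zero)
next
  case False
  with assms have c: "c > 0" by simp
  have lim: "filterlim (\<lambda>\<alpha>. \<alpha> * c) (at_right 0) (at_right (0::real))"
    using c by (intro filterlim_at_right_0_mult[OF tendsto_const])
  have "((\<lambda>\<alpha>. c *\<^sub>R ((f (x + (\<alpha> * c) *\<^sub>R d) - f x) /\<^sub>R (\<alpha> * c))) \<longlongrightarrow> c *\<^sub>R v) (at_right 0)"
    by (intro tendsto_intros filterlim_compose[OF assms(1)[unfolded has_dir_deriv_def] lim])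
  moreover have "c *\<^sub>R ((f (x + (\<alpha> * c) *\<^sub>R d) - f x) /\<^sub>R (\<alpha> * c))
      = (f (x + \<alpha> *\<^sub>R (c *\<^sub>R d)) - f x) /\<^sub>R \<alpha>" for \<alpha>
    using c by simp
  ultimately show ?thesis
    unfolding has_dir_deriv_def by (simp only:)
qed

section \<open>Homogeneity and affinity along a direction\<close>

definition pos_homogeneous :: "('a::real_normed_vector \<Rightarrow> 'b::real_normed_vector) \<Rightarrow> bool" where
  "pos_homogeneous g \<longleftrightarrow> (\<forall>c\<ge>0. \<forall>d. g (c *\<^sub>R d) = c *\<^sub>R g d)"

definition affine_along ::
    "('a::real_normed_vector \<Rightarrow> 'b::real_normed_vector) \<Rightarrow> 'a \<Rightarrow> 'b \<Rightarrow> bool" where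
  "affine_along g u w \<longleftrightarrow> (\<forall>d t. g (d + t *\<^sub>R u) = g d + t *\<^sub>R w)"

lemma pos_homogeneous_zero: "pos_homogeneous g \<Longrightarrow> g 0 = 0"
  unfolding pos_homogeneous_def by (metis order_refl scaleR_zero_left)

lemma pos_homogeneous_dir_deriv:
  assumes "\<And>d. \<exists>v. has_dir_deriv g v x d"
  shows "pos_homogeneous (dir_deriv g x)"
  unfolding pos_homogeneous_def
  using dir_deriv_eq has_dir_deriv_scale has_dir_deriv_dir_deriv[OF assms] by blast

text \<open>For small \<open>\<alpha>\<close>, the point \<open>m + \<alpha> (d + t m)\<close> is the positive multiple \<open>1 + \<alpha> t\<close> of the point
  \<open>m + (\<alpha> / (1 + \<alpha> t)) d\<close>; homogeneity therefore turns the difference quotient in the direction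
  \<open>d + t m\<close> into one in the direction \<open>d\<close>, with a rescaled step, plus the constant \<open>t g(m)\<close>.\<close>

lemma affine_along_dir_deriv_base:
  assumes hom: "pos_homogeneous g" and ex: "\<And>d. \<exists>v. has_dir_deriv g v m d"
  shows "affine_along (dir_deriv g m) m (g m)"
  unfolding affine_along_def
proof (intro allI)
  fix d t
  define s where "s = (\<lambda>\<alpha>::real. inverse (1 + \<alpha> * t))"
  have one: "((\<lambda>\<alpha>::real. 1 + \<alpha> * t) \<longlongrightarrow> 1 + 0 * t) (at_right 0)"
    by (intro tendsto_intros)
  have "(s \<longlongrightarrow> inverse (1 + 0 * t)) (at_right 0)"
    unfolding s_def by (intro tendsto_intros) simp
  then have lim: "filterlim (\<lambda>\<alpha>. \<alpha> * s \<alpha>) (at_right 0) (at_right 0)"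
    by (intro filterlim_at_right_0_mult[where a = 1]) simp_all
  have pos: "eventually (\<lambda>\<alpha>. 1 + \<alpha> * t > 0) (at_right 0)"
    using one by (rule order_tendstoD) simp
  have "((\<lambda>\<alpha>. (g (m + (\<alpha> * s \<alpha>) *\<^sub>R d) - g m) /\<^sub>R (\<alpha> * s \<alpha>) + t *\<^sub>R g m)
          \<longlongrightarrow> dir_deriv g m d + t *\<^sub>R g m) (at_right 0)"
    by (intro tendsto_intros filterlim_compose[OF _ lim]
        has_dir_deriv_dir_deriv[OF ex, unfolded has_dir_deriv_def])
  moreover have "eventually (\<lambda>\<alpha>. (g (m + (\<alpha> * s \<alpha>) *\<^sub>R d) - g m) /\<^sub>R (\<alpha> * s \<alpha>) + t *\<^sub>R g m
      = (g (m + \<alpha> *\<^sub>R (d + t *\<^sub>R m)) - g m) /\<^sub>R \<alpha>) (at_right 0)"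
    using pos eventually_at_right_less
  proof eventually_elim
    case (elim \<alpha>)
    define p where "p = 1 + \<alpha> * t"
    have p: "p > 0" "s \<alpha> = inverse p"
      using elim by (auto simp: p_def s_def)
    have "m + \<alpha> *\<^sub>R (d + t *\<^sub>R m) = p *\<^sub>R (m + (\<alpha> * s \<alpha>) *\<^sub>R d)"
    proof -
      have "p *\<^sub>R (m + (\<alpha> * s \<alpha>) *\<^sub>R d) = p *\<^sub>R m + \<alpha> *\<^sub>R d"
        using p by (simp add: scaleR_add_right)
      then show ?thesis
        by (simp add: p_def algebra_simps)
    qed
    then have *: "g (m + \<alpha> *\<^sub>R (d + t *\<^sub>R m)) = p *\<^sub>R g (m + (\<alpha> * s \<alpha>) *\<^sub>R d)"
      using hom p by (simp add: pos_homogeneous_def)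
    have "(inverse \<alpha> * p) *\<^sub>R g m = inverse \<alpha> *\<^sub>R g m + t *\<^sub>R g m"
      using elim by (simp add: p_def field_simps flip: scaleR_add_left)
    then show ?case
      using p elim unfolding * by (simp add: scaleR_diff_right mult.commute)
  qed
  ultimately have "has_dir_deriv g (dir_deriv g m d + t *\<^sub>R g m) m (d + t *\<^sub>R m)"
    unfolding has_dir_deriv_def by (rule Lim_transform_eventually)
  then show "dir_deriv g m (d + t *\<^sub>R m) = dir_deriv g m d + t *\<^sub>R g m"
    by (rule dir_deriv_eq)
qed

text \<open>Moving the direction by \<open>t u\<close> moves the evaluation point by \<open>\<alpha> t u\<close>, which adds the constant
  \<open>t w\<close> to the difference quotient. So every later homogenization inherits the slopes of the earlier
  ones.\<close>

lemma affine_along_dir_deriv: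
  assumes aff: "affine_along g u w" and ex: "\<And>d. \<exists>v. has_dir_deriv g v m d"
  shows "affine_along (dir_deriv g m) u w"
  unfolding affine_along_def
proof (intro allI)
  fix d t
  have "((\<lambda>\<alpha>. (g (m + \<alpha> *\<^sub>R d) - g m) /\<^sub>R \<alpha> + t *\<^sub>R w) \<longlongrightarrow> dir_deriv g m d + t *\<^sub>R w) (at_right 0)"
    by (intro tendsto_intros has_dir_deriv_dir_deriv[OF ex, unfolded has_dir_deriv_def])
  moreover have "eventually (\<lambda>\<alpha>. (g (m + \<alpha> *\<^sub>R d) - g m) /\<^sub>R \<alpha> + t *\<^sub>R w
      = (g (m + \<alpha> *\<^sub>R (d + t *\<^sub>R u)) - g m) /\<^sub>R \<alpha>) (at_right 0)"
    using eventually_at_right_less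
  proof eventually_elim
    case (elim \<alpha>)
    have "m + \<alpha> *\<^sub>R (d + t *\<^sub>R u) = (m + \<alpha> *\<^sub>R d) + (\<alpha> * t) *\<^sub>R u"
      by (simp add: algebra_simps)
    then have "g (m + \<alpha> *\<^sub>R (d + t *\<^sub>R u)) = g (m + \<alpha> *\<^sub>R d) + (\<alpha> * t) *\<^sub>R w"
      using aff by (simp only: affine_along_def)
    then show ?case
      using elim by (simp add: algebra_simps)
  qed
  ultimately have "has_dir_deriv g (dir_deriv g m d + t *\<^sub>R w) m (d + t *\<^sub>R u)"
    unfolding has_dir_deriv_def by (rule Lim_transform_eventually)
  then show "dir_deriv g m (d + t *\<^sub>R u) = dir_deriv g m d + t *\<^sub>R w"
    by (rule dir_deriv_eq)
qed

section \<open>The LD-derivative as a linear map\<close>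

lemma pos_homogeneous_homogenization:
  assumes "homogenization_exists f x k m" "j \<le> k"
  shows "pos_homogeneous (homogenization f x m j)"
  using assms
  by (cases j) (auto simp: homogenization_exists_def Suc_le_eq intro!: pos_homogeneous_dir_deriv)

lemma affine_along_homogenization:
  assumes ex: "homogenization_exists f x k m" and "l < j" "j \<le> k"
  shows "affine_along (homogenization f x m j) (m (Suc l)) (homogenization f x m l (m (Suc l)))"
  using \<open>l < j\<close> \<open>j \<le> k\<close>
proof (induction j)
  case 0
  then show ?case by simp
next
  case (Suc j)
  have dd: "\<exists>v. has_dir_deriv (homogenization f x m j) v (m (Suc j)) d" for d
    using ex Suc.prems by (simp add: homogenization_exists_def)
  show ?case
  proof (cases "l = j")
    case True
    have "pos_homogeneous (homogenization f x m j)"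
      using ex Suc.prems by (intro pos_homogeneous_homogenization) auto
    with True dd show ?thesis
      by (simp add: affine_along_dir_deriv_base)
  next
    case False
    with Suc dd show ?thesis
      by (simp add: affine_along_dir_deriv)
  qed
qed

text \<open>With \<open>g 0 = 0\<close> and \<open>d = 0\<close> this is linearity of \<open>g\<close> in the coefficients, even when the \<open>u i\<close> are
  linearly dependent, as the columns of \<open>[d I]\<close> are.\<close>

lemma affine_along_sum:
  assumes "finite A" "\<And>i. i \<in> A \<Longrightarrow> affine_along g (u i) (w i)"
  shows "g (d + (\<Sum>i\<in>A. t i *\<^sub>R u i)) = g d + (\<Sum>i\<in>A. t i *\<^sub>R w i)"
  using assms
proof (induction A)
  case empty
  then show ?case by simp
next
  case (insert a A)
  then have "g ((d + (\<Sum>i\<in>A. t i *\<^sub>R u i)) + t a *\<^sub>R u a) =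
      g (d + (\<Sum>i\<in>A. t i *\<^sub>R u i)) + t a *\<^sub>R w a"
    by (simp only: affine_along_def insert_iff simp_thms)
  with insert show ?case
    by (simp add: algebra_simps)
qed

lemma sorted_list_of_set_nth_card_lessThan:
  "sorted_list_of_set UNIV ! card {..<j} = (j :: 'k::{finite,linorder})"
proof -
  let ?xs = "sorted_list_of_set (UNIV :: 'k set)"
  have len: "length ?xs = CARD('k)"
    by simp
  obtain i where i: "i < length ?xs" "?xs ! i = j"
    by (metis UNIV_I finite_UNIV in_set_conv_nth set_sorted_list_of_set finite)
  have lt: "?xs ! a < ?xs ! b \<longleftrightarrow> a < b" if "a < length ?xs" "b < length ?xs" for a b
    using that strict_sorted_list_of_set[of "UNIV :: 'k set"]
    by (metis linorder_neqE_nat order_less_asym sorted_wrt_nth_less)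
  have "{..<j} = (!) ?xs ` {..<i}"
  proof (intro set_eqI iffI)
    fix y assume y: "y \<in> {..<j}"
    obtain b where "b < length ?xs" "?xs ! b = y"
      by (metis UNIV_I in_set_conv_nth set_sorted_list_of_set finite)
    with y i lt show "y \<in> (!) ?xs ` {..<i}" by force
  next
    fix y assume "y \<in> (!) ?xs ` {..<i}"
    with i lt show "y \<in> {..<j}" by force
  qed
  moreover have "inj_on ((!) ?xs) {..<i}"
    using i by (intro inj_on_nth) auto
  ultimately have "card {..<j} = i"
    by (simp add: card_image)
  with i show ?thesis by simp
qed

lemma nth_column_card_lessThan: "nth_column M (Suc (card {..<j})) = column j M"
  by (simp add: nth_column_def sorted_list_of_set_nth_card_lessThan)

lemma homogenization_affine_along_column:
  fixes M :: "real ^ ('k::{finite,linorder}) ^ 'n"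
  assumes "homogenization_exists f x CARD('k) (nth_column M)"
  shows "affine_along (homogenization f x (nth_column M) CARD('k)) (column j M)
           (homogenization f x (nth_column M) (card {..<j}) (column j M))"
proof -
  have "{..<j} \<subset> UNIV" by blast
  then have "card {..<j} < CARD('k)" by (intro psubset_card_mono) auto
  then show ?thesis
    using affine_along_homogenization[OF assms] nth_column_card_lessThan[of M j] by force
qed

lemma LD_deriv_mult_vec:
  fixes M :: "real ^ ('k::{finite,linorder}) ^ 'n"
  assumes "homogenization_exists f x CARD('k) (nth_column M)"
  shows "LD_deriv f x M *v w = homogenization f x (nth_column M) CARD('k) (M *v w)"
proof -
  let ?g = "homogenization f x (nth_column M) CARD('k)"
  let ?c = "\<lambda>j. homogenization f x (nth_column M) (card {..<j}) (column j M)"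
  have "column j (LD_deriv f x M) = ?c j" for j
    by (simp add: column_def LD_deriv_def vec_eq_iff)
  then have "LD_deriv f x M *v w = (\<Sum>j\<in>UNIV. w $ j *\<^sub>R ?c j)"
    by (simp add: matrix_mult_sum scalar_mult_eq_scaleR)
  also have "\<dots> = ?g (0 + (\<Sum>j\<in>UNIV. w $ j *\<^sub>R column j M))"
    using pos_homogeneous_zero[OF pos_homogeneous_homogenization[OF assms order_refl]]
    by (subst affine_along_sum[OF finite homogenization_affine_along_column[OF assms]]) simp
  finally show ?thesis
    by (simp add: matrix_mult_sum scalar_mult_eq_scaleR)
qed

lemma cons_column_mult_cons_entry: "cons_column d A *v cons_entry a v = a *\<^sub>R d + A *v v"
  by (simp add: vec_eq_iff matrix_vector_mult_def cons_column_def cons_entry_def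
      UNIV_option_conv sum.reindex)

lemma LD_deriv_cons_column_mat_1:
  fixes f :: "real ^ ('n::{finite,linorder}) \<Rightarrow> real ^ 'm"
  assumes "homogenization_exists f x CARD('n option) (nth_column (cons_column d (mat 1)))"
  shows "LD_deriv f x (cons_column d (mat 1)) *v cons_entry 0 d = dir_deriv f x d"
proof -
  let ?M = "cons_column d (mat 1 :: real ^ ('n::{finite,linorder}) ^ ('n::{finite,linorder}))"
  let ?g = "homogenization f x (nth_column ?M) CARD('n option)"
  have "LD_deriv f x ?M *v cons_entry 0 d = ?g d"
    by (simp add: LD_deriv_mult_vec[OF assms] cons_column_mult_cons_entry del: card_option)
  also have "?g d = dir_deriv f x d"
  proof -
    have "column None ?M = d"
      by (simp add: column_def cons_column_def vec_eq_iff)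
    moreover have "card {..<None :: 'n option} = 0"
      by (simp add: lessThan_def)
    ultimately have "affine_along ?g d (dir_deriv f x d)"
      using homogenization_affine_along_column[OF assms, of None] by simp
    then have "?g (0 + 1 *\<^sub>R d) = ?g 0 + 1 *\<^sub>R dir_deriv f x d"
      unfolding affine_along_def by blast
    then show ?thesis
      using pos_homogeneous_zero[OF pos_homogeneous_homogenization[OF assms order_refl]] by simp
  qed
  finally show ?thesis .
qed

section \<open>First-order approximation by directional derivatives\<close>

lemma lipschitz_has_dir_deriv_dist:
  assumes lip: "L-lipschitz_on (cball x r) f" and "r > 0"
    and "has_dir_deriv f v x d" "has_dir_deriv f w x e"
  shows "norm (v - w) \<le> L * norm (d - e)"
proof -
  have "((\<lambda>\<alpha>. norm ((f (x + \<alpha> *\<^sub>R d) - f x) /\<^sub>R \<alpha> - (f (x + \<alpha> *\<^sub>R e) - f x) /\<^sub>R \<alpha>))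
      \<longlongrightarrow> norm (v - w)) (at_right 0)"
    by (intro tendsto_intros assms(3,4)[unfolded has_dir_deriv_def])
  moreover
  have in_ball: "eventually (\<lambda>\<alpha>. x + \<alpha> *\<^sub>R y \<in> cball x r) (at_right 0)" for y
  proof -
    have "((\<lambda>\<alpha>. norm (\<alpha> *\<^sub>R y)) \<longlongrightarrow> norm (0 *\<^sub>R y)) (at_right 0)"
      by (intro tendsto_intros)
    then have "eventually (\<lambda>\<alpha>. norm (\<alpha> *\<^sub>R y) < r) (at_right 0)"
      by (rule order_tendstoD) (use \<open>r > 0\<close> in simp)
    then show ?thesis
      by eventually_elim (simp add: dist_norm)
  qed
  have "eventually (\<lambda>\<alpha>. norm ((f (x + \<alpha> *\<^sub>R d) - f x) /\<^sub>R \<alpha> - (f (x + \<alpha> *\<^sub>R e) - f x) /\<^sub>R \<alpha>)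
      \<le> L * norm (d - e)) (at_right 0)"
    using in_ball[of d] in_ball[of e] eventually_at_right_less
  proof eventually_elim
    case (elim \<alpha>)
    have "norm (f (x + \<alpha> *\<^sub>R d) - f (x + \<alpha> *\<^sub>R e)) \<le> L * norm (\<alpha> *\<^sub>R d - \<alpha> *\<^sub>R e)"
      using lipschitz_onD[OF lip elim(1,2)] by (simp add: dist_norm)
    also have "\<dots> = L * norm (d - e) * \<alpha>"
      using elim by (simp flip: scaleR_diff_right)
    finally have "norm (f (x + \<alpha> *\<^sub>R d) - f (x + \<alpha> *\<^sub>R e)) / \<alpha> \<le> L * norm (d - e)"
      using elim by (simp add: pos_divide_le_eq)
    moreover have "(f (x + \<alpha> *\<^sub>R d) - f x) /\<^sub>R \<alpha> - (f (x + \<alpha> *\<^sub>R e) - f x) /\<^sub>R \<alpha>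
        = (f (x + \<alpha> *\<^sub>R d) - f (x + \<alpha> *\<^sub>R e)) /\<^sub>R \<alpha>"
      by (simp add: algebra_simps)
    ultimately show ?case
      using elim by (simp add: divide_inverse mult.commute)
  qed
  ultimately show ?thesis
    by (rule tendsto_upperbound) simp
qed

text \<open>Both \<open>\<alpha> \<mapsto> f (x + \<alpha> d)\<close>, up to a factor \<open>\<alpha>\<close>, and \<open>h\<close> depend on the direction in a Lipschitz
  way with the same constant. So the error in a unit direction is at most the error in a net
  direction nearby plus twice the Lipschitz bound, and finitely many net directions admit a common
  step length.\<close>

lemma lipschitz_imp_B_differentiable:
  fixes f :: "'a::euclidean_space \<Rightarrow> 'b::real_normed_vector"
  assumes lip: "L-lipschitz_on (cball x r) f" and r: "r > 0"
    and h: "\<And>d. has_dir_deriv f (h d) x d"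
  shows "((\<lambda>d. norm (f (x + d) - f x - h d) / norm d) \<longlongrightarrow> 0) (at 0)"
proof (rule tendstoI)
  fix \<epsilon> :: real assume "\<epsilon> > 0"
  have L: "L \<ge> 0" using lip by (rule lipschitz_on_nonneg)
  \<comment> \<open>An error \<open>\<eta>\<close> on the net, and \<open>L \<eta>\<close> twice for passing to the net, in \<open>f\<close> and in \<open>h\<close>.\<close>
  define \<eta> where "\<eta> = \<epsilon> / (2 * L + 2)"
  have \<eta>: "\<eta> > 0" "(2 * L + 1) * \<eta> < \<epsilon>"
    using L \<open>\<epsilon> > 0\<close> by (auto simp: \<eta>_def field_simps)
  have hom: "h (c *\<^sub>R d) = c *\<^sub>R h d" if "c \<ge> 0" for c d
    using has_dir_deriv_unique[OF h has_dir_deriv_scale[OF h that]] .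
  obtain N where N: "finite N" "sphere (0::'a) 1 \<subseteq> (\<Union>u\<in>N. ball u \<eta>)" "N \<subseteq> sphere 0 1"
    by (rule compactE_image[OF compact_sphere[of "0::'a" 1], of "sphere 0 1" "\<lambda>u. ball u \<eta>"])
      (use \<eta> in auto)
  have "eventually (\<lambda>\<alpha>. norm ((f (x + \<alpha> *\<^sub>R u) - f x) /\<^sub>R \<alpha> - h u) < \<eta>) (at_right 0)" for u
    using tendstoD[OF h[unfolded has_dir_deriv_def] \<eta>(1)] by (simp add: dist_norm)
  then have "eventually (\<lambda>\<alpha>. \<forall>u\<in>N. norm ((f (x + \<alpha> *\<^sub>R u) - f x) /\<^sub>R \<alpha> - h u) < \<eta>) (at_right 0)"
    using N(1) by (simp add: eventually_ball_finite)
  then obtain \<delta> where \<delta>: "\<delta> > 0"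
    "\<And>\<alpha> u. 0 < \<alpha> \<Longrightarrow> \<alpha> < \<delta> \<Longrightarrow> u \<in> N \<Longrightarrow> norm ((f (x + \<alpha> *\<^sub>R u) - f x) /\<^sub>R \<alpha> - h u) < \<eta>"
    by (auto simp: eventually_at_right_field)
  have bound: "norm (f (x + d) - f x - h d) / norm d < \<epsilon>"
    if d: "d \<noteq> 0" "norm d < \<delta>" "norm d < r" for d
  proof -
    define \<alpha> where "\<alpha> = norm d"
    define v where "v = d /\<^sub>R \<alpha>"
    have \<alpha>: "0 < \<alpha>" "\<alpha> < \<delta>" "\<alpha> < r" and v: "norm v = 1" "d = \<alpha> *\<^sub>R v"
      using d by (auto simp: \<alpha>_def v_def)
    then obtain u where u: "u \<in> N" "dist u v < \<eta>"
      using N(2) by fastforce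
    have nu: "norm u = 1" using u N(3) by auto
    have uv: "norm (v - u) \<le> \<eta>" using u by (simp add: dist_norm norm_minus_commute)
    have "norm (f (x + \<alpha> *\<^sub>R v) - f (x + \<alpha> *\<^sub>R u)) \<le> L * norm (\<alpha> *\<^sub>R v - \<alpha> *\<^sub>R u)"
      using lipschitz_onD[OF lip, of "x + \<alpha> *\<^sub>R v" "x + \<alpha> *\<^sub>R u"] \<alpha> v nu by (simp add: dist_norm)
    also have "\<dots> = \<alpha> * (L * norm (v - u))"
      using \<alpha> by (simp flip: scaleR_diff_right)
    also have "\<dots> \<le> \<alpha> * (L * \<eta>)"
      using \<alpha> L uv by (intro mult_left_mono) auto
    finally have 1: "norm (f (x + \<alpha> *\<^sub>R v) - f (x + \<alpha> *\<^sub>R u)) \<le> \<alpha> * (L * \<eta>)" .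
    have "f (x + \<alpha> *\<^sub>R u) - f x - \<alpha> *\<^sub>R h u = \<alpha> *\<^sub>R ((f (x + \<alpha> *\<^sub>R u) - f x) /\<^sub>R \<alpha> - h u)"
      using \<alpha> by (simp add: algebra_simps)
    then have 2: "norm (f (x + \<alpha> *\<^sub>R u) - f x - \<alpha> *\<^sub>R h u) \<le> \<alpha> * \<eta>"
      using \<delta>(2)[OF \<alpha>(1,2) u(1)] \<alpha> by simp
    have "norm (h u - h v) \<le> L * \<eta>"
      using lipschitz_has_dir_deriv_dist[OF lip r h h, of u v] uv L
      by (smt (verit, ccfv_SIG) mult_left_mono norm_minus_commute)
    then have 3: "norm (\<alpha> *\<^sub>R (h u - h v)) \<le> \<alpha> * (L * \<eta>)"
      using \<alpha> by simp
    have "f (x + d) - f x - h d = (f (x + \<alpha> *\<^sub>R v) - f (x + \<alpha> *\<^sub>R u))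
        + (f (x + \<alpha> *\<^sub>R u) - f x - \<alpha> *\<^sub>R h u) + \<alpha> *\<^sub>R (h u - h v)"
      using \<alpha> v(2) by (simp add: hom algebra_simps)
    also have "norm \<dots> \<le> \<alpha> * (L * \<eta>) + \<alpha> * \<eta> + \<alpha> * (L * \<eta>)"
      using 1 2 3 by (intro norm_triangle_mono)
    also have "\<dots> = \<alpha> * ((2 * L + 1) * \<eta>)"
      by (simp add: algebra_simps)
    also have "\<dots> < \<alpha> * \<epsilon>"
      using \<alpha> \<eta> by simp
    finally show ?thesis
      using \<alpha> by (simp add: \<alpha>_def pos_divide_less_eq mult.commute)
  qed
  show "eventually (\<lambda>d. dist (norm (f (x + d) - f x - h d) / norm d) 0 < \<epsilon>) (at 0)"
    unfolding eventually_at
    by (rule exI[of _ "min \<delta> r"]) (use \<delta>(1) r bound in auto)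
qed

section \<open>The approximation by LD-derivatives\<close>

theorem mainTheorem1:
  fixes X :: "(real ^ ('n::{finite,linorder})) set"
    and f :: "real ^ ('n::{finite,linorder}) \<Rightarrow> real ^ ('n::{finite,linorder})"
    and x0 :: "real ^ ('n::{finite,linorder})"
  assumes "open X" and "x0 \<in> X" and "L_smooth_at X f x0"
  shows "((\<lambda>d. 1 / norm d *
            norm (f (x0 + d) - f x0 - LD_deriv f x0 (cons_column d (mat 1)) *v cons_entry 0 d))
          \<longlongrightarrow> 0) (at 0)"
proof -
  have ex: "homogenization_exists f x0 k m" for k m
    using assms(3) by (simp add: L_smooth_at_def)
  have dd: "has_dir_deriv f (dir_deriv f x0 d) x0 d" for d
    using ex by (intro has_dir_deriv_dir_deriv) (simp add: homogenization_exists_def)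
  obtain r L where r: "r > 0" and lip: "L-lipschitz_on (cball x0 r \<inter> X) f"
    using assms(2,3) unfolding L_smooth_at_def locally_lipschitz_on_def by blast
  obtain e where e: "e > 0" "cball x0 e \<subseteq> X"
    using assms(1,2) open_contains_cball by blast
  have "L-lipschitz_on (cball x0 (min r e)) f"
    using lip by (rule lipschitz_on_subset) (use e in auto)
  then have "((\<lambda>d. norm (f (x0 + d) - f x0 - dir_deriv f x0 d) / norm d) \<longlongrightarrow> 0) (at 0)"
    by (rule lipschitz_imp_B_differentiable) (use r e dd in auto)
  then show ?thesis
    by (simp add: LD_deriv_cons_column_mat_1[OF ex])
qed

end
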